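(* There is an absolute constant $c>0$ such that the following holds. For any integer $d\ge 2$, any $\mu>0$ and any $D>0$, there exist a compact, smooth, and strongly convex set $\mathcal{X}\subset\mathbb{R}^d$ with $\operatorname{diam}(\mathcal{X})=D$ and a $\mu$-strongly convex and smooth function $f:\mathbb{R}^d\to\mathbb{R}$ such that for all $T\in\mathbb{N}$ there exists a starting point $x_0\in\mathcal{X}$ such that the sequence $\{x_t\}_{t=0}^T$ produced by the Frank–Wolfe algorithm with short steps (or exact line search) started at $x_0$ satisfies $$f(x_t)-f(x^* )\ \ge\ c\,\frac{\mu D^2}{t^2}\qquad\text{for all } t=1,\dots,T,$$ where $x^*\in\arg\min_{x\in\mathcal{X}}f(x)$; that is, $f(x_t)-f(x^* )\ge\Omega(\mu D^2/t^2)$ or, equivalently, $T=\Omega(\sqrt{\mu D^2/\varepsilon})$ iterations are needed to reach primal gap at most $\varepsilon$.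
   Context: $\|\cdot\|$ is the Euclidean norm and $B_r(x)=\{y\in\mathbb{R}^d:\|y-x\|\le r\}$. A (differentiable) function $f:\mathbb{R}^d\to\mathbb{R}$ is $\mu$-strongly convex if $f(x)\ge f(y)+\langle\nabla f(y),x-y\rangle+\frac{\mu}{2}\|x-y\|^2$ for all $x,y$, and $L$-smooth if $f(x)\le f(y)+\langle\nabla f(y),x-y\rangle+\frac{L}{2}\|x-y\|^2$ for all $x,y$; smooth means $L$-smooth for some $L>0$. For a closed convex set $\mathcal{X}\subset\mathbb{R}^d$ and $x\in\partial\mathcal{X}$ let $N_{\mathcal{X}}(x)=\{n:\langle n,y-x\rangle\le 0\ \forall y\in\mathcal{X}\}$. $\mathcal{X}$ is $\alpha$-strongly convex if $\mathcal{X}\subset B_\alpha(x-\alpha n)$ for every $x\in\partial\mathcal{X}$ and every $n\in N_{\mathcal{X}}(x)$ with $\|n\|=1$; it is $\beta$-smooth if $B_\beta(x-\beta n)\subset\mathcal{X}$ for all such $x,n$. The set is called strongly convex (resp. smooth) if this holds for some $\alpha>0$ (resp. $\beta>0$). The Frank–Wolfe algorithm for $\min_{x\in\mathcal{X}}f(x)$ starts from $x_0\in\mathcal{X}$ and iterates $v_t\in\arg\min_{v\in\mathcal{X}}\langle\nabla f(x_t),v\rangle$, $x_{t+1}=(1-\gamma_t)x_t+\gamma_t v_t$, with $\gamma_t\in[0,1]$. Short steps: $\gamma_t=\min\left\{1,\frac{\langle\nabla f(x_t),x_t-v_t\rangle}{L\|x_t-v_t\|^2}\right\}$, where $L$ is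 the smoothness constant of $f$ (if $x_t=v_t$ the step size is irrelevant). Exact line search: $\gamma_t=\arg\min_{\gamma\in[0,1]}f(x_t+\gamma(v_t-x_t))$. *)

theory Defs
  imports "HOL-Analysis.Analysis"
begin

text \<open>
  The dimension is quantified inside the scope of an absolute constant, so it has to be a natural
  number rather than a type. We therefore work in the library's \<^const>\<open>Euclidean_space\<close>, whose
  points are the sequences that vanish from index \<open>d\<close> on. Its topology is the Euclidean one, but
  the metric that the library puts on the type \<^typ>\<open>nat \<Rightarrow> real\<close> is not the Euclidean
  metric, and that type is not a vector space instance; hence the explicit norm, inner product,
  convexity and diameter below.
\<close>

abbreviation Rn :: "nat \<Rightarrow> (nat \<Rightarrow> real) set" where
  "Rn d \<equiv> topspace (Euclidean_space d)"

definition ip :: "nat \<Rightarrow> (nat \<Rightarrow> real) \<Rightarrow> (nat \<Rightarrow> real) \<Rightarrow> real" where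
  "ip d x y = (\<Sum>i<d. x i * y i)"

abbreviation nrm :: "nat \<Rightarrow> (nat \<Rightarrow> real) \<Rightarrow> real" where
  "nrm d x \<equiv> L2_set x {..<d}"

definition ball_Rn :: "nat \<Rightarrow> real \<Rightarrow> (nat \<Rightarrow> real) \<Rightarrow> (nat \<Rightarrow> real) set" where
  "ball_Rn d r x = {y \<in> Rn d. nrm d (y - x) \<le> r}"

definition diam :: "nat \<Rightarrow> (nat \<Rightarrow> real) set \<Rightarrow> real" where
  "diam d X = (SUP p\<in>X \<times> X. nrm d (fst p - snd p))"

definition convex_Rn :: "nat \<Rightarrow> (nat \<Rightarrow> real) set \<Rightarrow> bool" where
  "convex_Rn d X \<longleftrightarrow> X \<subseteq> Rn d \<and>
     (\<forall>x\<in>X. \<forall>y\<in>X. \<forall>s\<in>{0..1}. (\<lambda>i. (1 - s) * x i + s * y i) \<in> X)"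


definition has_gradient ::
    "nat \<Rightarrow> ((nat \<Rightarrow> real) \<Rightarrow> real) \<Rightarrow> (nat \<Rightarrow> real) \<Rightarrow> (nat \<Rightarrow> real) \<Rightarrow> bool" where
  "has_gradient d f y g \<longleftrightarrow> g \<in> Rn d \<and>
     ((\<lambda>x. (f x - f y - ip d g (x - y)) / nrm d (x - y)) \<longlongrightarrow> 0) (atin (Euclidean_space d) y)"

definition differentiable_Rn :: "nat \<Rightarrow> ((nat \<Rightarrow> real) \<Rightarrow> real) \<Rightarrow> bool" where
  "differentiable_Rn d f \<longleftrightarrow> (\<forall>y\<in>Rn d. \<exists>g. has_gradient d f y g)"

definition grad :: "nat \<Rightarrow> ((nat \<Rightarrow> real) \<Rightarrow> real) \<Rightarrow> (nat \<Rightarrow> real) \<Rightarrow> (nat \<Rightarrow> real)" where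
  "grad d f y = (THE g. has_gradient d f y g)"

definition strongly_convex_fun :: "nat \<Rightarrow> real \<Rightarrow> ((nat \<Rightarrow> real) \<Rightarrow> real) \<Rightarrow> bool" where
  "strongly_convex_fun d \<mu> f \<longleftrightarrow> differentiable_Rn d f \<and>
     (\<forall>x\<in>Rn d. \<forall>y\<in>Rn d.
        f x \<ge> f y + ip d (grad d f y) (x - y) + \<mu> / 2 * (nrm d (x - y))\<^sup>2)"

definition L_smooth_fun :: "nat \<Rightarrow> real \<Rightarrow> ((nat \<Rightarrow> real) \<Rightarrow> real) \<Rightarrow> bool" where
  "L_smooth_fun d L f \<longleftrightarrow> differentiable_Rn d f \<and>
     (\<forall>x\<in>Rn d. \<forall>y\<in>Rn d.
        f x \<le> f y + ip d (grad d f y) (x - y) + L / 2 * (nrm d (x - y))\<^sup>2)"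

definition smooth_fun :: "nat \<Rightarrow> ((nat \<Rightarrow> real) \<Rightarrow> real) \<Rightarrow> bool" where
  "smooth_fun d f \<longleftrightarrow> (\<exists>L>0. L_smooth_fun d L f)"

text \<open>
  \<open>L_smooth_fun\<close> is monotone in \<open>L\<close>; the smoothness constant of \<open>f\<close> is the best such \<open>L\<close>.
  For smooth \<open>f\<close> that are \<open>\<mu>\<close>-strongly convex with \<open>\<mu> > 0\<close> and \<open>d \<ge> 1\<close>, the infimum is attained
  and at least \<open>\<mu>\<close>.
\<close>

definition smoothness_const :: "nat \<Rightarrow> ((nat \<Rightarrow> real) \<Rightarrow> real) \<Rightarrow> real" where
  "smoothness_const d f = Inf {L. L > 0 \<and> L_smooth_fun d L f}"


definition normal_cone :: "nat \<Rightarrow> (nat \<Rightarrow> real) set \<Rightarrow> (nat \<Rightarrow> real) \<Rightarrow> (nat \<Rightarrow> real) set" where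
  "normal_cone d X x = {n \<in> Rn d. \<forall>y\<in>X. ip d n (y - x) \<le> 0}"

definition alpha_strongly_convex_set :: "nat \<Rightarrow> real \<Rightarrow> (nat \<Rightarrow> real) set \<Rightarrow> bool" where
  "alpha_strongly_convex_set d \<alpha> X \<longleftrightarrow> closedin (Euclidean_space d) X \<and> convex_Rn d X \<and>
     (\<forall>x \<in> Euclidean_space d frontier_of X. \<forall>n \<in> normal_cone d X x.
        nrm d n = 1 \<longrightarrow> X \<subseteq> ball_Rn d \<alpha> (\<lambda>i. x i - \<alpha> * n i))"

definition beta_smooth_set :: "nat \<Rightarrow> real \<Rightarrow> (nat \<Rightarrow> real) set \<Rightarrow> bool" where
  "beta_smooth_set d \<beta> X \<longleftrightarrow> closedin (Euclidean_space d) X \<and> convex_Rn d X \<and>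
     (\<forall>x \<in> Euclidean_space d frontier_of X. \<forall>n \<in> normal_cone d X x.
        nrm d n = 1 \<longrightarrow> ball_Rn d \<beta> (\<lambda>i. x i - \<beta> * n i) \<subseteq> X)"

definition strongly_convex_set :: "nat \<Rightarrow> (nat \<Rightarrow> real) set \<Rightarrow> bool" where
  "strongly_convex_set d X \<longleftrightarrow> (\<exists>\<alpha>>0. alpha_strongly_convex_set d \<alpha> X)"

definition smooth_set :: "nat \<Rightarrow> (nat \<Rightarrow> real) set \<Rightarrow> bool" where
  "smooth_set d X \<longleftrightarrow> (\<exists>\<beta>>0. beta_smooth_set d \<beta> X)"


text \<open>
  A run consists of iterates \<open>x\<close>, oracle answers \<open>v\<close> and step sizes \<open>\<gamma>\<close>. It is a relation because
  the oracle may return any minimiser. Only \<open>x 0, \<dots>, x T\<close> and the first \<open>T\<close> entries of \<open>v\<close>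
  and \<open>\<gamma>\<close> are constrained.
\<close>

definition FW_run ::
    "nat \<Rightarrow> (nat \<Rightarrow> real) set \<Rightarrow> ((nat \<Rightarrow> real) \<Rightarrow> real) \<Rightarrow> nat \<Rightarrow> (nat \<Rightarrow> real) \<Rightarrow>
     (nat \<Rightarrow> nat \<Rightarrow> real) \<Rightarrow> (nat \<Rightarrow> nat \<Rightarrow> real) \<Rightarrow> (nat \<Rightarrow> real) \<Rightarrow> bool" where
  "FW_run d X f T x0 x v \<gamma> \<longleftrightarrow> x 0 = x0 \<and>
     (\<forall>t<T. is_arg_min (\<lambda>u. ip d (grad d f (x t)) u) (\<lambda>u. u \<in> X) (v t) \<and>
            \<gamma> t \<in> {0..1} \<and>
            x (Suc t) = (\<lambda>i. (1 - \<gamma> t) * x t i + \<gamma> t * v t i))"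

definition short_steps ::
    "nat \<Rightarrow> ((nat \<Rightarrow> real) \<Rightarrow> real) \<Rightarrow> nat \<Rightarrow>
     (nat \<Rightarrow> nat \<Rightarrow> real) \<Rightarrow> (nat \<Rightarrow> nat \<Rightarrow> real) \<Rightarrow> (nat \<Rightarrow> real) \<Rightarrow> bool" where
  "short_steps d f T x v \<gamma> \<longleftrightarrow>
     (\<forall>t<T. x t \<noteq> v t \<longrightarrow>
        \<gamma> t = min 1 (ip d (grad d f (x t)) (x t - v t) /
                      (smoothness_const d f * (nrm d (x t - v t))\<^sup>2)))"

definition exact_line_search ::
    "((nat \<Rightarrow> real) \<Rightarrow> real) \<Rightarrow> nat \<Rightarrow>
     (nat \<Rightarrow> nat \<Rightarrow> real) \<Rightarrow> (nat \<Rightarrow> nat \<Rightarrow> real) \<Rightarrow> (nat \<Rightarrow> real) \<Rightarrow> bool" where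
  "exact_line_search f T x v \<gamma> \<longleftrightarrow>
     (\<forall>t<T. is_arg_min (\<lambda>s. f (\<lambda>i. x t i + s * (v t i - x t i))) (\<lambda>s. s \<in> {0..1}) (\<gamma> t))"

end

theory Submission
  imports Defs
begin

text \<open>
  The hard instance is the ball of radius \<open>R = D/2\<close> around the origin with the objective
  \<open>f x = \<mu>/2 \<parallel>x - p\<parallel>\<^sup>2\<close>, where the unconstrained minimiser \<open>p\<close> lies on the boundary sphere. The
  gradient vanishes at the optimum, so the faster rates known for optima where it does not vanish, or
  that lie in the interior, do not apply.

  The two step rules agree on this objective. One step depends on \<open>x\<close> only through the distance
  \<open>R \<rho>\<close> to \<open>p\<close> and the cosine \<open>1 - u\<close> of the angle between \<open>p - x\<close> and \<open>p\<close>, and it maps these to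
  \<open>\<rho>' = \<rho> m\<close> and \<open>u' = 1 - (1 + \<rho>) m\<close>, where \<open>m\<^sup>2 = u (2 - u) / (2 u (1 + \<rho>) + \<rho>\<^sup>2)\<close> (\<open>polar_step\<close>).
  If \<open>u\<close> is comparable to \<open>\<rho>\<close>, then \<open>1 - m\<close> is only of order \<open>\<rho>\<close>, which makes \<open>\<rho>\<close> decay like \<open>1/t\<close>
  and the primal gap like \<open>1/t\<^sup>2\<close>. More precisely, \<open>u' \<le> \<rho>'\<close> alone gives \<open>1/\<rho>' \<le> 1/\<rho> + 2\<close>
  (\<open>slow_orbit\<close>).

  It remains to keep \<open>u\<close> comparable to \<open>\<rho>\<close> for \<open>T\<close> steps. For small \<open>\<rho>\<close> the ratio \<open>\<kappa> = u/\<rho>\<close> follows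
  approximately the map \<open>\<kappa> \<mapsto> (\<kappa> - 1)\<^sup>2 / (4 \<kappa>)\<close>, whose fixed point \<open>\<kappa> = 1/3\<close> is repelling, so orbits
  that start near it tend to drift away. Yet this expansion is what makes a good starting point exist: the window \<open>\<rho>/10 \<le> u \<le> \<rho>\<close> is stretched over itself with its
  orientation reversed (\<open>shrink_lower_edge\<close>, \<open>shrink_upper_edge\<close>), so the orbits of the two edges stay
  outside the window on opposite sides once \<open>u\<close> is clamped to it before every step. By the
  intermediate value theorem some initial \<open>u\<close> in between is inside at time \<open>T\<close>. As an orbit that has
  left the window never returns under the clamped step, this orbit was inside at all earlier times and
  is an orbit of the true algorithm (\<open>orbit_inside_window\<close>). The starting point obtained in this way
  depends on \<open>T\<close>, while the ball and the objective do not.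
\<close>

section \<open>Inner products and balls\<close>

lemma nrm_sq: "(nrm d x)\<^sup>2 = ip d x x"
  by (simp add: L2_set_def ip_def sum_nonneg power2_eq_square)

lemma ip_self_nonneg: "0 \<le> ip d x x"
  by (simp add: ip_def sum_nonneg)

lemma ip_self_eq_0_D: "ip d x x \<le> 0 \<Longrightarrow> i < d \<Longrightarrow> x i = 0"
  using sum_nonneg_eq_0_iff[of "{..<d}" "\<lambda>i. x i * x i"] ip_self_nonneg[of d x]
  by (auto simp: ip_def)

lemma ip_commute: "ip d x y = ip d y x"
  by (simp add: ip_def mult.commute)

lemma ip_cong:
  assumes "\<And>i. i < d \<Longrightarrow> x i = x' i" "\<And>i. i < d \<Longrightarrow> y i = y' i"
  shows "ip d x y = ip d x' y'"
  using assms by (simp add: ip_def)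

lemma ip_combination_left: "ip d (\<lambda>i. a * x i + b * y i) z = a * ip d x z + b * ip d y z"
  unfolding ip_def sum_distrib_left sum.distrib[symmetric]
  by (rule sum.cong) (auto simp: algebra_simps)

lemma ip_combination_self:
  "ip d (\<lambda>i. a * x i + b * y i) (\<lambda>i. a * x i + b * y i)
     = a\<^sup>2 * ip d x x + 2 * a * b * ip d x y + b\<^sup>2 * ip d y y"
  unfolding ip_def sum_distrib_left sum.distrib[symmetric]
  by (rule sum.cong) (auto simp: algebra_simps power2_eq_square)

lemma nrm_eqI: "0 \<le> a \<Longrightarrow> ip d x x = a\<^sup>2 \<Longrightarrow> nrm d x = a"
  using power2_eq_iff_nonneg[OF L2_set_nonneg, of a x "{..<d}"] by (simp add: nrm_sq)

text \<open>
  The squared distance from \<open>z\<close> to \<open>R n\<close> expands to at most \<open>R\<^sup>2 - 2 R\<^sup>2 + R\<^sup>2 = 0\<close>.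
  The lemma serves twice: it identifies the outer normals of a ball, and it identifies the vertex
  that linear minimisation over a ball returns.
\<close>

lemma extreme_point_of_ball:
  assumes n: "ip d n n = 1" and z: "ip d z z \<le> R\<^sup>2" and R: "R \<ge> 0" and nz: "R \<le> ip d n z"
    and i: "i < d"
  shows "z i = R * n i"
proof -
  have "ip d (\<lambda>i. 1 * z i + (-R) * n i) (\<lambda>i. 1 * z i + (-R) * n i)
      = ip d z z - 2 * R * ip d n z + R\<^sup>2"
    using n by (simp only: ip_combination_self ip_commute[of d z n]) simp
  also have "\<dots> \<le> 0"
    using z mult_left_mono[OF nz R] by (simp add: power2_eq_square)
  finally show ?thesis
    using ip_self_eq_0_D[OF _ i] by fastforce
qed

section \<open>Gradients in Euclidean space\<close>

lemma Euclidean_space_top_of_set: "Euclidean_space d = top_of_set {x. \<forall>i\<ge>d. x i = 0}"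
  by (simp add: Euclidean_space_def euclidean_product_topology)

lemma Rn_combination:
  "x \<in> Rn d \<Longrightarrow> y \<in> Rn d \<Longrightarrow> (\<lambda>i. a * x i + b * y i) \<in> Rn d"
  by (simp add: topspace_Euclidean_space)

lemma Rn_ext: "x \<in> Rn d \<Longrightarrow> y \<in> Rn d \<Longrightarrow> (\<And>i. i < d \<Longrightarrow> x i = y i) \<Longrightarrow> x = y"
  by (rule ext) (metis (mono_tags, lifting) mem_Collect_eq not_less topspace_Euclidean_space)

lemma atin_Euclidean_space:
  assumes "y \<in> Rn d" shows "atin (Euclidean_space d) y = at y within Rn d"
proof -
  have "atin (Euclidean_space d) y = atin_within euclidean y (Rn d)"
    using assms atin_subtopology_within[of y "{x. \<forall>i\<ge>d. x i = 0}" euclidean]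
    unfolding topspace_Euclidean_space by (simp add: Euclidean_space_top_of_set)
  then show ?thesis
    by (simp add: atin_within_def at_within_def nhdsin_def nhds_def)
qed

lemma continuous_on_nrm:
  fixes d :: nat and p :: "nat \<Rightarrow> real"
  shows "continuous_on S (\<lambda>x. nrm d (x - p))"
  unfolding L2_set_def fun_diff_def
  by (intro continuous_intros continuous_on_subset[OF continuous_on_product_coordinates]) auto

lemma tendsto_nrm_diff: "((\<lambda>x. nrm d (x - y)) \<longlongrightarrow> 0) (at y within Rn d)"
proof -
  have "nrm d (y - y) = 0"
    by (simp add: L2_set_def)
  then show ?thesis
    using continuous_on_nrm[where S = UNIV and d = d and p = y]
      continuous_on_imp_continuous_within[of UNIV "\<lambda>x. nrm d (x - y)" "Rn d" y]
    by (auto simp: continuous_within)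
qed

text \<open>
  Subtracting the two difference quotients shows that \<open>\<langle>g - h, x - y\<rangle> / \<parallel>x - y\<parallel>\<close> tends to \<open>0\<close>. Along the
  ray from \<open>y\<close> in direction \<open>g - h\<close> this quotient is constantly \<open>\<parallel>g - h\<parallel>\<close>.
\<close>

lemma has_gradient_unique:
  assumes y: "y \<in> Rn d" and g: "has_gradient d f y g" and h: "has_gradient d f y h"
  shows "g = h"
proof -
  define k where "k = (\<lambda>i. 1 * g i + (-1) * h i)"
  have gR: "g \<in> Rn d" and hR: "h \<in> Rn d"
    using g h by (auto simp: has_gradient_def)
  have kR: "k \<in> Rn d"
    unfolding k_def by (rule Rn_combination[OF gR hR])
  have "((\<lambda>x. (f x - f y - ip d h (x - y)) / nrm d (x - y) - (f x - f y - ip d g (x - y)) / nrm d (x - y))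
        \<longlongrightarrow> 0 - 0) (at y within Rn d)"
    using g h unfolding has_gradient_def atin_Euclidean_space[OF y] by (intro tendsto_diff) auto
  moreover have "(f x - f y - ip d h (x - y)) / nrm d (x - y) - (f x - f y - ip d g (x - y)) / nrm d (x - y)
      = ip d k (x - y) / nrm d (x - y)" for x
    unfolding k_def ip_combination_left by (simp add: diff_divide_distrib)
  ultimately have lim: "((\<lambda>x. ip d k (x - y) / nrm d (x - y)) \<longlongrightarrow> 0) (at y within Rn d)"
    by simp
  have "nrm d k = 0"
  proof (rule ccontr)
    assume "nrm d k \<noteq> 0"
    then have kpos: "nrm d k > 0"
      using L2_set_nonneg[of k] by (simp add: order_less_le)
    then obtain j where j: "k j \<noteq> 0"
      by (metis (mono_tags, lifting) L2_set_0' less_irrefl)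
    have "continuous_on UNIV (\<lambda>s::real. \<lambda>i. y i + s * k i)"
      by (intro continuous_on_coordinatewise_then_product continuous_intros)
    then have "((\<lambda>s::real. \<lambda>i. y i + s * k i) \<longlongrightarrow> (\<lambda>i. y i + 0 * k i)) (at 0)"
      by (simp only: continuous_on_def UNIV_I ball_simps)
    then have "((\<lambda>s::real. \<lambda>i. y i + s * k i) \<longlongrightarrow> (\<lambda>i. y i + 0 * k i)) (at_right 0)"
      by (rule tendsto_within_subset) simp
    moreover have "eventually (\<lambda>s::real. (\<lambda>i. y i + s * k i) \<in> Rn d \<and> (\<lambda>i. y i + s * k i) \<noteq> y) (at_right 0)"
      using eventually_at_right_less[of 0]
    proof eventually_elim
      case (elim s)
      then have "y j + s * k j \<noteq> y j" using j by simp
      then show ?case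
        using y kR by (auto simp: topspace_Euclidean_space dest: fun_cong)
    qed
    ultimately have "filterlim (\<lambda>s::real. \<lambda>i. y i + s * k i) (at y within Rn d) (at_right 0)"
      by (simp add: filterlim_at)
    from filterlim_compose[OF lim this]
    have "((\<lambda>s. ip d k ((\<lambda>i. y i + s * k i) - y) / nrm d ((\<lambda>i. y i + s * k i) - y)) \<longlongrightarrow> 0) (at_right 0)" .
    moreover have "eventually (\<lambda>s. ip d k ((\<lambda>i. y i + s * k i) - y) / nrm d ((\<lambda>i. y i + s * k i) - y) = nrm d k)
       (at_right 0)"
      using eventually_at_right_less[of 0]
    proof eventually_elim
      case (elim s)
      have "(\<lambda>i. y i + s * k i) - y = (\<lambda>i. s * k i)" by auto
      moreover have "ip d k (\<lambda>i. s * k i) = s * (nrm d k)\<^sup>2"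
        by (simp add: nrm_sq ip_def sum_distrib_left algebra_simps)
      moreover have "nrm d (\<lambda>i. s * k i) = s * nrm d k"
        using elim by (simp add: L2_set_right_distrib)
      ultimately show ?case using elim kpos by (simp add: power2_eq_square)
    qed
    ultimately have "((\<lambda>s::real. nrm d k) \<longlongrightarrow> 0) (at_right 0)"
      using tendsto_cong by fast
    then show False using kpos by (simp add: tendsto_const_iff)
  qed
  then have "ip d k k \<le> 0"
    by (simp flip: nrm_sq)
  then show ?thesis
    using ip_self_eq_0_D by (intro Rn_ext[OF gR hR]) (force simp: k_def)
qed

section \<open>The quadratic objective\<close>

definition sqdist_fun :: "nat \<Rightarrow> real \<Rightarrow> (nat \<Rightarrow> real) \<Rightarrow> (nat \<Rightarrow> real) \<Rightarrow> real" where
  "sqdist_fun d \<mu> p x = \<mu> / 2 * (nrm d (x - p))\<^sup>2"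

text \<open>
  The second-order expansion is exact, so the strong convexity and the smoothness inequality are both
  equalities for the constant \<open>\<mu>\<close>, and the remainder in the definition of the gradient is explicit.
\<close>

lemma sqdist_fun_expand:
  "sqdist_fun d \<mu> p x = sqdist_fun d \<mu> p y + ip d (\<lambda>i. \<mu> * (y i - p i)) (x - y)
     + \<mu> / 2 * (nrm d (x - y))\<^sup>2"
  unfolding sqdist_fun_def nrm_sq ip_def sum_distrib_left sum.distrib[symmetric]
  by (rule sum.cong) (auto simp: field_simps)

lemma has_gradient_sqdist_fun:
  assumes y: "y \<in> Rn d" and p: "p \<in> Rn d"
  shows "has_gradient d (sqdist_fun d \<mu> p) y (\<lambda>i. \<mu> * (y i - p i))"
proof -
  have eq: "(sqdist_fun d \<mu> p x - sqdist_fun d \<mu> p y - ip d (\<lambda>i. \<mu> * (y i - p i)) (x - y)) / nrm d (x - y)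
      = \<mu> / 2 * nrm d (x - y)" for x
    using sqdist_fun_expand[of d \<mu> p x y] by (simp add: power2_eq_square)
  have "((\<lambda>x. \<mu> / 2 * nrm d (x - y)) \<longlongrightarrow> \<mu> / 2 * 0) (at y within Rn d)"
    by (intro tendsto_intros tendsto_nrm_diff)
  moreover have "(\<lambda>i. \<mu> * (y i - p i)) \<in> Rn d"
    using Rn_combination[OF y p, of \<mu> "-\<mu>"] by (simp add: right_diff_distrib)
  ultimately show ?thesis
    unfolding has_gradient_def atin_Euclidean_space[OF y] eq by simp
qed

lemma grad_sqdist_fun:
  assumes "y \<in> Rn d" "p \<in> Rn d"
  shows "grad d (sqdist_fun d \<mu> p) y = (\<lambda>i. \<mu> * (y i - p i))"
  unfolding grad_def
  using has_gradient_sqdist_fun[OF assms] has_gradient_unique[OF assms(1)] by (intro the_equality) auto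

lemma differentiable_sqdist_fun: "p \<in> Rn d \<Longrightarrow> differentiable_Rn d (sqdist_fun d \<mu> p)"
  unfolding differentiable_Rn_def using has_gradient_sqdist_fun by blast

lemma strongly_convex_sqdist_fun:
  "p \<in> Rn d \<Longrightarrow> strongly_convex_fun d \<mu> (sqdist_fun d \<mu> p)"
  unfolding strongly_convex_fun_def
  using sqdist_fun_expand[of d \<mu> p] by (simp add: differentiable_sqdist_fun grad_sqdist_fun)

definition unit_vec :: "nat \<Rightarrow> nat \<Rightarrow> real" where
  "unit_vec j = (\<lambda>i. if i = j then 1 else 0)"

lemma unit_vec_Rn: "j < d \<Longrightarrow> unit_vec j \<in> Rn d"
  by (simp add: topspace_Euclidean_space unit_vec_def)

lemma ip_unit_vec: "j < d \<Longrightarrow> ip d (unit_vec j) (unit_vec k) = (if j = k then 1 else 0)"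
  by (simp add: ip_def unit_vec_def if_distrib[where f = "\<lambda>a. a * _"] cong: if_cong)

text \<open>
  Testing the smoothness inequality on a single pair at distance \<open>1\<close> already forces \<open>\<mu> \<le> L\<close>; the
  bound \<open>d \<ge> 1\<close> provides such a pair.
\<close>

lemma L_smooth_sqdist_fun_iff:
  assumes "p \<in> Rn d" "d \<ge> 1"
  shows "L_smooth_fun d L (sqdist_fun d \<mu> p) \<longleftrightarrow> \<mu> \<le> L"
proof -
  have *: "sqdist_fun d \<mu> p x \<le> sqdist_fun d \<mu> p y + ip d (grad d (sqdist_fun d \<mu> p) y) (x - y) + L / 2 * (nrm d (x - y))\<^sup>2
      \<longleftrightarrow> \<mu> * (nrm d (x - y))\<^sup>2 \<le> L * (nrm d (x - y))\<^sup>2" if "y \<in> Rn d" for x y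
    unfolding grad_sqdist_fun[OF that assms(1)] using sqdist_fun_expand[of d \<mu> p x y] by auto
  show ?thesis
  proof
    assume L: "L_smooth_fun d L (sqdist_fun d \<mu> p)"
    have z: "(\<lambda>i. 0) \<in> Rn d" by (simp add: topspace_Euclidean_space)
    have u: "unit_vec 0 \<in> Rn d" using assms by (intro unit_vec_Rn) auto
    have one: "(nrm d (unit_vec 0 - (\<lambda>i. 0)))\<^sup>2 = 1"
      using ip_unit_vec[of 0 d 0] assms(2) by (simp add: nrm_sq fun_diff_def)
    have "\<mu> * (nrm d (unit_vec 0 - (\<lambda>i. 0)))\<^sup>2 \<le> L * (nrm d (unit_vec 0 - (\<lambda>i. 0)))\<^sup>2"
      by (rule *[OF z, THEN iffD1]) (use L z u in \<open>unfold L_smooth_fun_def, blast\<close>)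
    then show "\<mu> \<le> L"
      unfolding one by simp
  next
    assume "\<mu> \<le> L"
    then have "\<mu> * (nrm d (x - y))\<^sup>2 \<le> L * (nrm d (x - y))\<^sup>2" for x y
      by (rule mult_right_mono) simp
    then show "L_smooth_fun d L (sqdist_fun d \<mu> p)"
      unfolding L_smooth_fun_def
      by (intro conjI ballI differentiable_sqdist_fun[OF assms(1)]) (rule *[THEN iffD2])
  qed
qed

lemma smoothness_const_sqdist_fun:
  assumes "p \<in> Rn d" "d \<ge> 1" "\<mu> > 0"
  shows "smoothness_const d (sqdist_fun d \<mu> p) = \<mu>"
proof -
  have "{L. L > 0 \<and> L_smooth_fun d L (sqdist_fun d \<mu> p)} = {\<mu>..}"
    using assms by (auto simp: L_smooth_sqdist_fun_iff)
  then show ?thesis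
    by (simp add: smoothness_const_def)
qed

section \<open>The ball as a smooth and strongly convex set\<close>

lemma mem_origin_ball: "0 \<le> R \<Longrightarrow> x \<in> ball_Rn d R (\<lambda>i. 0) \<longleftrightarrow> x \<in> Rn d \<and> ip d x x \<le> R\<^sup>2"
  using nrm_sq[where d=d and x=x] by (simp add: ball_Rn_def fun_diff_def flip: nrm_sq)

lemma closed_ball_Rn: "closedin (Euclidean_space d) (ball_Rn d r p)"
proof -
  let ?S = "{x::nat \<Rightarrow> real. \<forall>i\<ge>d. x i = 0}"
  have "closed {x. nrm d (x - p) \<le> r}"
    by (intro closed_Collect_le continuous_on_nrm continuous_on_const)
  then have "closedin (top_of_set ?S) (?S \<inter> {x. nrm d (x - p) \<le> r})"
    by (rule closedin_closed_Int)
  moreover have "?S \<inter> {x. nrm d (x - p) \<le> r} = ball_Rn d r p"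
    by (auto simp: ball_Rn_def topspace_Euclidean_space)
  ultimately show ?thesis
    by (simp add: Euclidean_space_top_of_set)
qed

text \<open>
  The ball is a closed subset of a product of compact sets of reals. Adjoining \<open>0\<close> to \<open>{-R..R}\<close>
  covers the vanishing coordinates from \<open>d\<close> on without a case distinction on the sign of \<open>R\<close>.
\<close>

lemma compact_origin_ball: "compactin (Euclidean_space d) (ball_Rn d R (\<lambda>i. 0))"
proof -
  have "ball_Rn d R (\<lambda>i. 0) \<subseteq> (\<Pi>\<^sub>E i\<in>UNIV. {-R..R} \<union> {0})"
  proof
    fix x assume x: "x \<in> ball_Rn d R (\<lambda>i. 0)"
    have "x i \<in> {-R..R} \<union> {0}" for i
    proof (cases "i < d")
      case True
      then have "\<bar>x i\<bar> \<le> nrm d x"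
        using member_le_L2_set[of "{..<d}" i "\<lambda>i. \<bar>x i\<bar>"] by (simp add: L2_set_def)
      then show ?thesis using x by (auto simp: ball_Rn_def fun_diff_def)
    qed (use x in \<open>simp add: ball_Rn_def topspace_Euclidean_space\<close>)
    then show "x \<in> (\<Pi>\<^sub>E i\<in>UNIV. {-R..R} \<union> {0})" by blast
  qed
  moreover have "compact (\<Pi>\<^sub>E i\<in>(UNIV::nat set). {-R..R} \<union> {0})"
    using compactin_PiE[of "\<lambda>_. euclideanreal" UNIV "\<lambda>_. {-R..R} \<union> {0}"]
    by (simp add: euclidean_product_topology)
  moreover have "closed (ball_Rn d R (\<lambda>i. 0))"
    using closedin_Euclidean_imp_closed[OF closed_ball_Rn] .
  ultimately have "compact (ball_Rn d R (\<lambda>i. 0))"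
    by (metis compact_Int_closed inf.absorb_iff2)
  then show ?thesis
    unfolding Euclidean_space_top_of_set
    by (auto simp: compactin_subtopology ball_Rn_def topspace_Euclidean_space)
qed

lemma convex_origin_ball:
  assumes "0 \<le> R" shows "convex_Rn d (ball_Rn d R (\<lambda>i. 0))"
  unfolding convex_Rn_def
proof (intro conjI ballI)
  fix x y and s :: real
  assume x: "x \<in> ball_Rn d R (\<lambda>i. 0)" and y: "y \<in> ball_Rn d R (\<lambda>i. 0)" and s: "s \<in> {0..1}"
  have "nrm d (\<lambda>i. (1 - s) * x i + s * y i) \<le> nrm d (\<lambda>i. (1 - s) * x i) + nrm d (\<lambda>i. s * y i)"
    by (rule L2_set_triangle_ineq)
  also have "\<dots> = (1 - s) * nrm d x + s * nrm d y"
    using s by (simp add: L2_set_right_distrib)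
  also have "\<dots> \<le> R"
    using x y s by (intro convex_bound_le) (auto simp: ball_Rn_def fun_diff_def)
  finally show "(\<lambda>i. (1 - s) * x i + s * y i) \<in> ball_Rn d R (\<lambda>i. 0)"
    using x y Rn_combination by (auto simp: ball_Rn_def fun_diff_def)
qed (auto simp: ball_Rn_def)

text \<open>
  Testing the normal inequality at the point \<open>R n\<close> of the ball gives \<open>\<langle>n, x\<rangle> \<ge> R\<close>, the equality case of
  Cauchy--Schwarz. Hence \<open>x - R n\<close> is the centre, and the ball itself is both the inscribed and the
  circumscribed ball that the definitions of a smooth and of a strongly convex set ask for.
\<close>

lemma origin_ball_normal:
  assumes R: "R > 0" and x: "x \<in> ball_Rn d R (\<lambda>i. 0)"
    and n: "n \<in> normal_cone d (ball_Rn d R (\<lambda>i. 0)) x" "nrm d n = 1"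
  shows "x = (\<lambda>i. R * n i)"
proof -
  have nn: "ip d n n = 1" using nrm_sq[where d=d and x=n] n by simp
  have nR: "n \<in> Rn d" using n by (simp add: normal_cone_def)
  have y: "(\<lambda>i. R * n i) \<in> ball_Rn d R (\<lambda>i. 0)"
    using ip_combination_self[of d R n 0 n] nn R Rn_combination[OF nR nR, of R 0] by (simp add: mem_origin_ball)
  then have "ip d n ((\<lambda>i. R * n i) - x) \<le> 0"
    using n by (auto simp: normal_cone_def)
  moreover have "ip d n ((\<lambda>i. R * n i) - x) = R * ip d n n - ip d n x"
    unfolding ip_def sum_distrib_left sum_subtractf[symmetric]
    by (rule sum.cong) (auto simp: algebra_simps)
  ultimately have "R \<le> ip d n x" using nn by simp
  then show ?thesis
    using x y R nn extreme_point_of_ball[OF nn] by (intro Rn_ext[of x d]) (auto simp: mem_origin_ball)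
qed

lemma origin_ball_smooth_strongly_convex:
  assumes R: "R > 0"
  shows "smooth_set d (ball_Rn d R (\<lambda>i. 0))" "strongly_convex_set d (ball_Rn d R (\<lambda>i. 0))"
proof -
  let ?X = "ball_Rn d R (\<lambda>i. 0)"
  have "(\<lambda>i. x i - R * n i) = (\<lambda>i. 0)"
    if "x \<in> Euclidean_space d frontier_of ?X" "n \<in> normal_cone d ?X x" "nrm d n = 1" for x n
    using origin_ball_normal[OF R _ that(2,3)] that(1) frontier_of_subset_closedin[OF closed_ball_Rn]
    by force
  then show "smooth_set d ?X" "strongly_convex_set d ?X"
    using R closed_ball_Rn convex_origin_ball[of R d]
    unfolding smooth_set_def beta_smooth_set_def strongly_convex_set_def alpha_strongly_convex_set_def
    by (auto intro!: exI[of _ R])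
qed

lemma diam_origin_ball:
  assumes R: "R > 0" and d: "d \<ge> 1"
  shows "diam d (ball_Rn d R (\<lambda>i. 0)) = 2 * R"
  unfolding diam_def
proof (rule cSup_eq_maximum)
  let ?X = "ball_Rn d R (\<lambda>i. 0)"
  have ee: "ip d (\<lambda>i. a * unit_vec 0 i) (\<lambda>i. a * unit_vec 0 i) = a\<^sup>2" for a
    using ip_combination_self[of d a "unit_vec 0" 0 "unit_vec 0"] ip_unit_vec[of 0 d 0] d by simp
  have un: "(\<lambda>i. a * unit_vec 0 i) \<in> Rn d" for a
    using Rn_combination[OF unit_vec_Rn unit_vec_Rn, of 0 d 0 a 0] d by simp
  have "nrm d ((\<lambda>i. R * unit_vec 0 i) - (\<lambda>i. (-R) * unit_vec 0 i)) = 2 * R"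
    using R ee[of "2*R"] by (intro nrm_eqI) (simp_all add: fun_diff_def mult.assoc)
  then show "2 * R \<in> (\<lambda>p. nrm d (fst p - snd p)) ` (?X \<times> ?X)"
    using ee un R by (intro image_eqI[of _ _ "(\<lambda>i. R * unit_vec 0 i, \<lambda>i. (-R) * unit_vec 0 i)"])
      (auto simp only: mem_origin_ball order_less_imp_le power2_minus mem_Times_iff fst_conv snd_conv order_refl)
next
  fix a assume "a \<in> (\<lambda>p. nrm d (fst p - snd p)) ` (ball_Rn d R (\<lambda>i. 0) \<times> ball_Rn d R (\<lambda>i. 0))"
  then obtain x y where a: "a = nrm d (x - y)" and "nrm d x \<le> R" "nrm d y \<le> R"
    by (auto simp: ball_Rn_def fun_diff_def)
  moreover have "nrm d (\<lambda>i. x i + (- y i)) \<le> nrm d x + nrm d (\<lambda>i. - y i)"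
    by (rule L2_set_triangle_ineq)
  ultimately show "a \<le> 2 * R"
    by (simp add: fun_diff_def L2_set_def)
qed

section \<open>Slow orbits of the reduced dynamics\<close>

text \<open>
  The factor by which one Frank--Wolfe step multiplies the distance to the optimum, when that distance
  is \<open>\<rho>\<close> times the radius and the direction to the optimum has cosine \<open>1 - u\<close> with the outer normal
  there; see \<open>polar_step\<close> below.
\<close>

definition shrink :: "real \<Rightarrow> real \<Rightarrow> real" where
  "shrink \<rho> u = sqrt (u * (2 - u) / (2 * u * (1 + \<rho>) + \<rho>\<^sup>2))"

lemma shrink_pos_le_1:
  assumes "0 < \<rho>" "\<rho> \<le> 1/10" "\<rho>/10 \<le> u" "u \<le> \<rho>"
  shows "0 < shrink \<rho> u" "shrink \<rho> u \<le> 1"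
proof -
  have u: "0 < u" "u < 2" using assms by auto
  have q: "0 < 2 * u * (1 + \<rho>) + \<rho>\<^sup>2"
    using u assms by (intro add_pos_pos mult_pos_pos) auto
  have "u * (2 - u) \<le> 2 * u * (1 + \<rho>) + \<rho>\<^sup>2"
    using u assms by (simp add: algebra_simps power2_eq_square)
  then show "shrink \<rho> u \<le> 1"
    using q by (simp add: shrink_def)
  show "0 < shrink \<rho> u"
    using q u by (simp add: shrink_def)
qed

text \<open>
  This and the next lemma are the expansion property: one step sends the edge \<open>u = \<rho>/10\<close> of the
  window to or above its upper edge, and the edge \<open>u = \<rho>\<close> to or below its lower edge. To first order
  in \<open>\<rho>\<close>, the ratio \<open>\<kappa> = u/\<rho>\<close> evolves by \<open>\<kappa> \<mapsto> (\<kappa> - 1)\<^sup>2 / (4 \<kappa>)\<close>, which sends \<open>1/10\<close> to about \<open>2\<close>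
  and \<open>1\<close> to \<open>0\<close>. Both images miss the window by a fixed margin, and for \<open>\<rho> \<le> 1/10\<close> that margin
  absorbs the higher-order terms.
\<close>

lemma shrink_lower_edge:
  assumes "0 < \<rho>" "\<rho> \<le> 1/10"
  shows "(1 + 2 * \<rho>) * shrink \<rho> (\<rho>/10) \<le> 1"
proof -
  have q: "0 < 2 * (\<rho>/10) * (1 + \<rho>) + \<rho>\<^sup>2"
    using assms by (intro add_pos_pos mult_pos_pos) auto
  have "2 * (\<rho>/10) * (1 + \<rho>) + \<rho>\<^sup>2 - (1 + 2 * \<rho>)\<^sup>2 * (\<rho>/10 * (2 - \<rho>/10))
      = \<rho>\<^sup>2 * (41/100 - 76/100 * \<rho> + 4/100 * \<rho>\<^sup>2)"
    by (simp add: power2_eq_square field_simps)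
  moreover have "0 \<le> \<rho>\<^sup>2 * (41/100 - 76/100 * \<rho> + 4/100 * \<rho>\<^sup>2)"
    using assms zero_le_power2[of \<rho>] by (intro mult_nonneg_nonneg) (auto simp del: zero_le_power2)
  ultimately have "(1 + 2 * \<rho>)\<^sup>2 * (\<rho>/10 * (2 - \<rho>/10) / (2 * (\<rho>/10) * (1 + \<rho>) + \<rho>\<^sup>2)) \<le> 1"
    using q by (simp add: field_simps)
  moreover have "((1 + 2 * \<rho>) * shrink \<rho> (\<rho>/10))\<^sup>2 =
      (1 + 2 * \<rho>)\<^sup>2 * (\<rho>/10 * (2 - \<rho>/10) / (2 * (\<rho>/10) * (1 + \<rho>) + \<rho>\<^sup>2))"
    unfolding shrink_def power_mult_distrib using q assms by (subst real_sqrt_pow2) auto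
  ultimately have "((1 + 2 * \<rho>) * shrink \<rho> (\<rho>/10))\<^sup>2 \<le> 1\<^sup>2"
    by simp
  then show ?thesis
    by (rule power2_le_imp_le) simp
qed

lemma shrink_upper_edge:
  assumes "0 < \<rho>" "\<rho> \<le> 1/10"
  shows "1 \<le> (1 + 11/10 * \<rho>) * shrink \<rho> \<rho>"
proof -
  have q: "0 < 2 * \<rho> * (1 + \<rho>) + \<rho>\<^sup>2"
    using assms by (intro add_pos_pos mult_pos_pos) auto
  have "(1 + 11/10 * \<rho>)\<^sup>2 * (\<rho> * (2 - \<rho>)) - (2 * \<rho> * (1 + \<rho>) + \<rho>\<^sup>2)
      = \<rho>\<^sup>2 * (4/10 + 22/100 * \<rho> - 121/100 * \<rho>\<^sup>2)"
    by (simp add: power2_eq_square field_simps)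
  moreover have "0 \<le> \<rho>\<^sup>2 * (4/10 + 22/100 * \<rho> - 121/100 * \<rho>\<^sup>2)"
    using assms power_mono[of \<rho> "1/10" 2] by (intro mult_nonneg_nonneg) (auto simp: power2_eq_square)
  ultimately have "1 \<le> (1 + 11/10 * \<rho>)\<^sup>2 * (\<rho> * (2 - \<rho>) / (2 * \<rho> * (1 + \<rho>) + \<rho>\<^sup>2))"
    using q by (simp add: field_simps)
  moreover have "((1 + 11/10 * \<rho>) * shrink \<rho> \<rho>)\<^sup>2 =
      (1 + 11/10 * \<rho>)\<^sup>2 * (\<rho> * (2 - \<rho>) / (2 * \<rho> * (1 + \<rho>) + \<rho>\<^sup>2))"
    unfolding shrink_def power_mult_distrib using q assms by (subst real_sqrt_pow2) auto
  ultimately have "1\<^sup>2 \<le> ((1 + 11/10 * \<rho>) * shrink \<rho> \<rho>)\<^sup>2"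
    by simp
  moreover have "0 \<le> (1 + 11/10 * \<rho>) * shrink \<rho> \<rho>"
    using assms shrink_pos_le_1(1)[of \<rho> \<rho>] by simp
  ultimately show ?thesis
    by (rule power2_le_imp_le)
qed

text \<open>
  Clamping \<open>u\<close> makes the step continuous in the initial value everywhere, including where the true
  step would leave the window, and it makes every \<open>u\<close> outside the window behave like the nearer edge.
\<close>

definition clamp_window :: "real \<Rightarrow> real \<Rightarrow> real" where
  "clamp_window \<rho> u = max (\<rho>/10) (min \<rho> u)"

text \<open>
  Pairs \<open>(\<rho>, u)\<close>. An orbit that stays inside the window is an orbit of the true step.
\<close>

primrec clamped_orbit :: "real \<Rightarrow> nat \<Rightarrow> real \<times> real" where
  "clamped_orbit s 0 = (1/10, s)"
| "clamped_orbit s (Suc t) = (case clamped_orbit s t of (\<rho>, u) \<Rightarrow>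
     let m = shrink \<rho> (clamp_window \<rho> u) in (\<rho> * m, 1 - (1 + \<rho>) * m))"

lemma clamped_orbit_Suc:
  fixes s t
  defines "\<rho> \<equiv> fst (clamped_orbit s t)"
  defines "m \<equiv> shrink \<rho> (clamp_window \<rho> (snd (clamped_orbit s t)))"
  shows "fst (clamped_orbit s (Suc t)) = \<rho> * m" "snd (clamped_orbit s (Suc t)) = 1 - (1 + \<rho>) * m"
  by (simp_all add: \<rho>_def m_def case_prod_beta Let_def)

lemma clamp_window_bounds: "0 < \<rho> \<Longrightarrow> \<rho>/10 \<le> clamp_window \<rho> u \<and> clamp_window \<rho> u \<le> \<rho>"
  by (simp add: clamp_window_def)

lemma clamped_orbit_fst: "0 < fst (clamped_orbit s t) \<and> fst (clamped_orbit s t) \<le> 1/10"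
proof (induction t)
  case (Suc t)
  let ?\<rho> = "fst (clamped_orbit s t)"
  let ?m = "shrink ?\<rho> (clamp_window ?\<rho> (snd (clamped_orbit s t)))"
  have "0 < ?m" "?m \<le> 1"
    using shrink_pos_le_1[of ?\<rho>] clamp_window_bounds Suc by auto
  then have "0 < ?\<rho> * ?m" "?\<rho> * ?m \<le> ?\<rho>"
    using Suc by (auto simp: mult_le_cancel_left1)
  then show ?case
    using Suc unfolding clamped_orbit_Suc by linarith
qed simp

lemma continuous_on_clamped_orbit:
  "continuous_on UNIV (\<lambda>s. fst (clamped_orbit s t)) \<and> continuous_on UNIV (\<lambda>s. snd (clamped_orbit s t))"
proof (induction t)
  case 0
  then show ?case by (auto intro!: continuous_intros)
next
  case (Suc t)
  have nz: "2 * clamp_window \<rho> u * (1 + \<rho>) + \<rho>\<^sup>2 \<noteq> 0" if "0 < \<rho>" for \<rho> u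
  proof -
    have "0 < 2 * clamp_window \<rho> u * (1 + \<rho>) + \<rho>\<^sup>2"
      using clamp_window_bounds[OF that, of u] that by (intro add_pos_pos mult_pos_pos) auto
    then show ?thesis by simp
  qed
  have "continuous_on UNIV (\<lambda>s. clamp_window (fst (clamped_orbit s t)) (snd (clamped_orbit s t)))"
    unfolding clamp_window_def using Suc by (auto intro!: continuous_intros)
  then have "continuous_on UNIV
      (\<lambda>s. shrink (fst (clamped_orbit s t)) (clamp_window (fst (clamped_orbit s t)) (snd (clamped_orbit s t))))"
    unfolding shrink_def using Suc nz clamped_orbit_fst by (auto intro!: continuous_intros)
  then show ?case
    unfolding clamped_orbit_Suc using Suc by (auto intro!: continuous_intros)
qed

lemma below_window_flips:
  assumes "snd (clamped_orbit s t) \<le> fst (clamped_orbit s t) / 10"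
  shows "fst (clamped_orbit s (Suc t)) \<le> snd (clamped_orbit s (Suc t))"
proof -
  let ?\<rho> = "fst (clamped_orbit s t)"
  have \<rho>: "0 < ?\<rho>" "?\<rho> \<le> 1/10" using clamped_orbit_fst by auto
  have eq: "clamp_window ?\<rho> (snd (clamped_orbit s t)) = ?\<rho>/10"
    using assms \<rho> by (simp add: clamp_window_def)
  show ?thesis
    using shrink_lower_edge[OF \<rho>] unfolding clamped_orbit_Suc eq by (simp add: algebra_simps)
qed

lemma above_window_flips:
  assumes "fst (clamped_orbit s t) \<le> snd (clamped_orbit s t)"
  shows "snd (clamped_orbit s (Suc t)) \<le> fst (clamped_orbit s (Suc t)) / 10"
proof -
  let ?\<rho> = "fst (clamped_orbit s t)"
  have \<rho>: "0 < ?\<rho>" "?\<rho> \<le> 1/10" using clamped_orbit_fst by auto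
  have eq: "clamp_window ?\<rho> (snd (clamped_orbit s t)) = ?\<rho>"
    using assms \<rho> by (simp add: clamp_window_def)
  show ?thesis
    using shrink_upper_edge[OF \<rho>] unfolding clamped_orbit_Suc eq by (simp add: algebra_simps)
qed

definition outside_window :: "real \<Rightarrow> nat \<Rightarrow> bool" where
  "outside_window s t \<longleftrightarrow> snd (clamped_orbit s t) \<le> fst (clamped_orbit s t) / 10
      \<or> fst (clamped_orbit s t) \<le> snd (clamped_orbit s t)"

text \<open>
  Clamping followed by expansion means that an orbit that has left the window jumps from one side of
  it to the other forever. So being inside at time \<open>T\<close> certifies that nothing was ever clamped before.
\<close>

lemma outside_window_persists:
  assumes "t \<le> t'" "outside_window s t"
  shows "outside_window s t'"
  using assms
proof (induction t' rule: dec_induct)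
  case (step n)
  then show ?case
    using below_window_flips[of s n] above_window_flips[of s n] unfolding outside_window_def by blast
qed

text \<open>
  The initial values \<open>1/100\<close> and \<open>1/10\<close> are the two edges of the window for \<open>\<rho> = 1/10\<close>; their orbits
  swap sides at every step and hence remain on opposite sides.
\<close>

lemma endpoints_opposite:
  "snd (clamped_orbit (1/100) t) \<le> fst (clamped_orbit (1/100) t) / 10
     \<and> fst (clamped_orbit (1/10) t) \<le> snd (clamped_orbit (1/10) t)
   \<or> fst (clamped_orbit (1/100) t) \<le> snd (clamped_orbit (1/100) t)
     \<and> snd (clamped_orbit (1/10) t) \<le> fst (clamped_orbit (1/10) t) / 10"
  by (induction t) (use below_window_flips above_window_flips in \<open>force simp del: clamped_orbit.simps(2)\<close>)+

text \<open>
  By continuity, some initial value between the two edges has \<open>u = \<rho>/2\<close> at time \<open>T\<close>, well inside the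
  window; persistence then covers all earlier times.
\<close>

lemma orbit_inside_window:
  "\<exists>s\<in>{1/100..1/10}. \<forall>t\<le>T. fst (clamped_orbit s t) / 10 < snd (clamped_orbit s t)
      \<and> snd (clamped_orbit s t) < fst (clamped_orbit s t)"
proof -
  let ?h = "\<lambda>s. snd (clamped_orbit s T) - fst (clamped_orbit s T) / 2"
  have cont: "continuous_on {1/100..1/10} ?h"
    using continuous_on_clamped_orbit[of T]
    by (intro continuous_on_diff continuous_on_divide continuous_on_const)
      (auto intro: continuous_on_subset)
  have "?h (1/100) \<le> 0 \<and> 0 \<le> ?h (1/10) \<or> ?h (1/10) \<le> 0 \<and> 0 \<le> ?h (1/100)"
    using endpoints_opposite[of T] clamped_orbit_fst[of "1/100" T] clamped_orbit_fst[of "1/10" T]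
    by linarith
  then obtain s where s: "s \<in> {1/100..1/10}" "?h s = 0"
    using IVT'[of ?h "1/100" 0 "1/10"] IVT2'[of ?h "1/10" 0 "1/100"] cont by fastforce
  then have "\<not> outside_window s T"
    using clamped_orbit_fst[of s T] by (simp add: outside_window_def)
  then have "\<not> outside_window s t" if "t \<le> T" for t
    using outside_window_persists that by blast
  then show ?thesis
    using s by (auto simp: outside_window_def not_le intro!: bexI[of _ s])
qed

text \<open>
  The quantitative decay comes from the window alone. With \<open>m\<close> the shrinking factor of a step,
  \<open>u' = 1 - (1 + \<rho>) m\<close> and \<open>\<rho>' = \<rho> m\<close>, the condition \<open>u' \<le> \<rho>'\<close> at the next time reads
  \<open>1 \<le> (1 + 2 \<rho>) m\<close>, that is \<open>1/\<rho>' \<le> 1/\<rho> + 2\<close>.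
\<close>

lemma slow_orbit:
  obtains \<rho> u :: "nat \<Rightarrow> real"
  where "\<rho> 0 = 1/10" "1/100 \<le> u 0" "u 0 \<le> 1/10"
    and "\<And>t. t \<le> T \<Longrightarrow> 0 < \<rho> t \<and> \<rho> t \<le> 1/10 \<and> \<rho> t / 10 < u t \<and> u t < \<rho> t \<and> 1 / (10 + 2 * real t) \<le> \<rho> t"
    and "\<And>t. t < T \<Longrightarrow> \<rho> (Suc t) = \<rho> t * shrink (\<rho> t) (u t)"
    and "\<And>t. t < T \<Longrightarrow> u (Suc t) = 1 - (1 + \<rho> t) * shrink (\<rho> t) (u t)"
proof -
  obtain s where s: "s \<in> {1/100..1/10}" and
    win: "\<And>t. t \<le> T \<Longrightarrow> fst (clamped_orbit s t) / 10 < snd (clamped_orbit s t)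
      \<and> snd (clamped_orbit s t) < fst (clamped_orbit s t)"
    using orbit_inside_window[of T] by blast
  define \<rho> u where "\<rho> = (\<lambda>t. fst (clamped_orbit s t))" and "u = (\<lambda>t. snd (clamped_orbit s t))"
  have pos: "0 < \<rho> t" "\<rho> t \<le> 1/10" for t
    using clamped_orbit_fst by (auto simp: \<rho>_def)
  have w: "\<rho> t / 10 < u t" "u t < \<rho> t" if "t \<le> T" for t
    using win that by (auto simp: \<rho>_def u_def)
  have step: "\<rho> (Suc t) = \<rho> t * shrink (\<rho> t) (u t)" "u (Suc t) = 1 - (1 + \<rho> t) * shrink (\<rho> t) (u t)"
    if "t < T" for t
  proof -
    have "clamp_window (\<rho> t) (u t) = u t"
      using w[of t] that by (simp add: clamp_window_def)
    then show "\<rho> (Suc t) = \<rho> t * shrink (\<rho> t) (u t)" "u (Suc t) = 1 - (1 + \<rho> t) * shrink (\<rho> t) (u t)"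
      by (auto simp only: \<rho>_def u_def clamped_orbit_Suc)
  qed
  have inv: "1 / \<rho> t \<le> 10 + 2 * real t" if "t \<le> T" for t
    using that
  proof (induction t)
    case 0
    then show ?case by (simp add: \<rho>_def)
  next
    case (Suc t)
    have "u (Suc t) < \<rho> (Suc t)" using w Suc.prems by blast
    then have "\<rho> t \<le> \<rho> (Suc t) * (1 + 2 * \<rho> t)"
      using step[of t] Suc.prems mult_left_mono[of 1 "(1 + 2 * \<rho> t) * shrink (\<rho> t) (u t)" "\<rho> t"] pos[of t]
      by (simp add: algebra_simps)
    then have "1 / \<rho> (Suc t) \<le> 1 / \<rho> t + 2"
      using pos[of t] pos[of "Suc t"] by (simp add: field_simps)
    then show ?case using Suc by simp
  qed
  have low: "1 / (10 + 2 * real t) \<le> \<rho> t" if "t \<le> T" for t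
  proof -
    have "1 \<le> (10 + 2 * real t) * \<rho> t"
      using inv[OF that] pos[of t] by (simp add: pos_divide_le_eq)
    then show ?thesis by (simp add: pos_divide_le_eq mult.commute)
  qed
  show thesis
    by (rule that[of \<rho> u]) (use s pos w step low in \<open>auto simp: \<rho>_def u_def\<close>)
qed

section \<open>A Frank--Wolfe step in polar coordinates around the optimum\<close>

text \<open>
  The negative gradient points from \<open>x\<close> to \<open>p\<close>, and the linear minimiser over a ball is the boundary
  point in that direction, so \<open>v = R (p - x) / \<parallel>p - x\<parallel>\<close>; here \<open>\<parallel>p - x\<parallel> = R \<delta>\<close>.
\<close>

lemma fw_direction:
  assumes R: "R > 0" and \<mu>: "\<mu> > 0" and x: "x \<in> Rn d" and p: "p \<in> Rn d" and \<delta>: "\<delta> > 0"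
    and rr: "ip d (\<lambda>i. p i - x i) (\<lambda>i. p i - x i) = (R * \<delta>)\<^sup>2"
    and v: "is_arg_min (\<lambda>w. ip d (grad d (sqdist_fun d \<mu> p) x) w) (\<lambda>w. w \<in> ball_Rn d R (\<lambda>i. 0)) v"
    and i: "i < d"
  shows "v i = (p i - x i) / \<delta>"
proof -
  define n where "n = (\<lambda>i. 1 / (R * \<delta>) * p i + (- 1 / (R * \<delta>)) * x i)"
  have n_eq: "n = (\<lambda>i. 1 / (R * \<delta>) * (p i - x i) + 0 * x i)"
    by (auto simp: n_def diff_divide_distrib)
  have nn: "ip d n n = 1"
    unfolding n_eq ip_combination_self rr using R \<delta> by (simp add: power_divide)
  have nR: "n \<in> Rn d"
    unfolding n_def by (rule Rn_combination[OF p x])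
  have "(\<lambda>i. R * n i) \<in> ball_Rn d R (\<lambda>i. 0)"
    using ip_combination_self[of d R n 0 n] nn R Rn_combination[OF nR nR, of R 0] by (simp add: mem_origin_ball)
  then have "ip d (\<lambda>i. \<mu> * (x i - p i)) v \<le> ip d (\<lambda>i. \<mu> * (x i - p i)) (\<lambda>i. R * n i)"
    using v unfolding is_arg_min_def grad_sqdist_fun[OF x p] by (meson not_le)
  moreover have *: "ip d (\<lambda>i. \<mu> * (x i - p i)) z = - (\<mu> * R * \<delta>) * ip d n z" for z
    unfolding n_def ip_def sum_distrib_left using R \<delta>
    by (intro sum.cong) (auto simp: field_simps)
  moreover have "ip d n (\<lambda>i. R * n i) = R"
    using ip_combination_left[of d R n 0 n n] nn by (simp add: ip_commute)
  ultimately have "\<mu> * R * \<delta> * R \<le> \<mu> * R * \<delta> * ip d n v"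
    by simp
  then have "R \<le> ip d n v"
    using R \<mu> \<delta> by simp
  moreover have "ip d v v \<le> R\<^sup>2"
    using v R by (simp add: is_arg_min_def mem_origin_ball)
  ultimately have "v i = R * n i"
    using extreme_point_of_ball[OF nn _ _ _ i] R by simp
  then show ?thesis
    using R \<delta> by (simp add: n_eq)
qed

lemma sqdist_fun_segment:
  assumes r: "r = (\<lambda>i. p i - x i)" and w: "w = (\<lambda>i. v i - x i)"
  shows "sqdist_fun d \<mu> p (\<lambda>i. x i + s * (v i - x i))
    = \<mu> / 2 * (ip d r r - 2 * s * ip d r w + s\<^sup>2 * ip d w w)"
proof -
  have "ip d ((\<lambda>i. x i + s * (v i - x i)) - p) ((\<lambda>i. x i + s * (v i - x i)) - p)
      = ip d (\<lambda>i. (-1) * r i + s * w i) (\<lambda>i. (-1) * r i + s * w i)"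
    by (rule ip_cong) (auto simp: r w)
  then show ?thesis
    unfolding sqdist_fun_def nrm_sq ip_combination_self by simp
qed

text \<open>
  For this quadratic, the short-step model is exact, so both rules select the minimiser of the same
  parabola along the segment. Its unconstrained minimiser lies in \<open>[0, 1]\<close> by the hypotheses, so
  neither truncation is active.
\<close>

lemma step_size:
  assumes \<mu>: "\<mu> > 0" and x: "x \<in> Rn d" and p: "p \<in> Rn d" and d: "d \<ge> 1"
    and r: "r = (\<lambda>i. p i - x i)" and w: "w = (\<lambda>i. v i - x i)"
    and B: "ip d w w > 0" and A: "0 \<le> ip d r w" "ip d r w \<le> ip d w w"
    and rule: "(x \<noteq> v \<longrightarrow> \<gamma> = min 1 (ip d (grad d (sqdist_fun d \<mu> p) x) (x - v) /
                      (smoothness_const d (sqdist_fun d \<mu> p) * (nrm d (x - v))\<^sup>2)))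
      \<or> is_arg_min (\<lambda>s. sqdist_fun d \<mu> p (\<lambda>i. x i + s * (v i - x i))) (\<lambda>s. s \<in> {0..1}) \<gamma>"
  shows "\<gamma> = ip d r w / ip d w w"
  using rule
proof
  assume short: "x \<noteq> v \<longrightarrow> \<gamma> = min 1 (ip d (grad d (sqdist_fun d \<mu> p) x) (x - v) /
                      (smoothness_const d (sqdist_fun d \<mu> p) * (nrm d (x - v))\<^sup>2))"
  have "x \<noteq> v"
    using B by (auto simp: w ip_def)
  moreover have "ip d (grad d (sqdist_fun d \<mu> p) x) (x - v) = \<mu> * ip d r w"
    unfolding grad_sqdist_fun[OF x p] r w ip_def sum_distrib_left
    by (intro sum.cong) (auto simp: algebra_simps)
  moreover have "(nrm d (x - v))\<^sup>2 = ip d w w"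
    unfolding nrm_sq by (auto simp: w ip_def algebra_simps intro!: sum.cong)
  ultimately have "\<gamma> = min 1 (ip d r w / ip d w w)"
    using short \<mu> smoothness_const_sqdist_fun[OF p d \<mu>] by simp
  then show ?thesis
    using A B by simp
next
  let ?A = "ip d r w" and ?B = "ip d w w"
  assume ls: "is_arg_min (\<lambda>s. sqdist_fun d \<mu> p (\<lambda>i. x i + s * (v i - x i))) (\<lambda>s. s \<in> {0..1}) \<gamma>"
  have "?A / ?B \<in> {0..1}"
    using A B by auto
  then have "sqdist_fun d \<mu> p (\<lambda>i. x i + \<gamma> * (v i - x i))
      \<le> sqdist_fun d \<mu> p (\<lambda>i. x i + (?A / ?B) * (v i - x i))"
    using ls unfolding is_arg_min_def by (meson not_le)
  then have "- 2 * \<gamma> * ?A + \<gamma>\<^sup>2 * ?B \<le> - 2 * (?A / ?B) * ?A + (?A / ?B)\<^sup>2 * ?B"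
    unfolding sqdist_fun_segment[OF r w] using \<mu> by simp
  \<comment> \<open>Completing the square: the excess of the parabola over its minimum.\<close>
  moreover have "?B * (\<gamma> - ?A / ?B)\<^sup>2 = (- 2 * \<gamma> * ?A + \<gamma>\<^sup>2 * ?B) - (- 2 * (?A / ?B) * ?A + (?A / ?B)\<^sup>2 * ?B)"
    using B by (simp add: field_simps power2_eq_square)
  ultimately have "?B * (\<gamma> - ?A / ?B)\<^sup>2 \<le> 0"
    by simp
  then show ?thesis
    using B by (simp add: mult_le_0_iff)
qed

text \<open>
  With \<open>\<parallel>p\<parallel> = R\<close>, the numbers \<open>R \<rho>\<close> and \<open>1 - u\<close> are the length of \<open>p - x\<close> and the cosine of its angle
  with \<open>p\<close>. They are recorded through inner products, which suffice to compute a whole step and keep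
  the argument independent of the dimension.
\<close>

definition polar_state :: "nat \<Rightarrow> real \<Rightarrow> (nat \<Rightarrow> real) \<Rightarrow> real \<Rightarrow> real \<Rightarrow> (nat \<Rightarrow> real) \<Rightarrow> bool" where
  "polar_state d R p \<rho> u x \<longleftrightarrow> x \<in> Rn d \<and>
     ip d (\<lambda>i. p i - x i) (\<lambda>i. p i - x i) = (R * \<rho>)\<^sup>2 \<and>
     ip d (\<lambda>i. p i - x i) p = R\<^sup>2 * \<rho> * (1 - u)"

text \<open>
  A step depends on \<open>x\<close> only through \<open>\<rho>\<close> and \<open>u\<close>: writing \<open>r = p - x\<close> and \<open>w = v - x = (1/\<rho> + 1) r - p\<close>,
  all products among \<open>r\<close>, \<open>w\<close> and \<open>p\<close> are functions of them. The new residual is the component of \<open>r\<close>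
  orthogonal to \<open>w\<close>, whence the factor \<open>m\<close> with \<open>m\<^sup>2 = u (2 - u) / (2 u (1 + \<rho>) + \<rho>\<^sup>2)\<close>, and its
  cosine with \<open>p\<close> comes out as \<open>(1 + \<rho>) m\<close>.
\<close>

lemma polar_step:
  assumes R: "R > 0" and \<mu>: "\<mu> > 0" and p: "p \<in> Rn d" and pp: "ip d p p = R\<^sup>2" and d: "d \<ge> 1"
    and \<rho>: "0 < \<rho>" "\<rho> \<le> 1/10" and u: "0 < u" "u \<le> \<rho>"
    and x: "polar_state d R p \<rho> u x"
    and v: "is_arg_min (\<lambda>w. ip d (grad d (sqdist_fun d \<mu> p) x) w) (\<lambda>w. w \<in> ball_Rn d R (\<lambda>i. 0)) v"
    and rule: "(x \<noteq> v \<longrightarrow> \<gamma> = min 1 (ip d (grad d (sqdist_fun d \<mu> p) x) (x - v) /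
                      (smoothness_const d (sqdist_fun d \<mu> p) * (nrm d (x - v))\<^sup>2)))
      \<or> is_arg_min (\<lambda>s. sqdist_fun d \<mu> p (\<lambda>i. x i + s * (v i - x i))) (\<lambda>s. s \<in> {0..1}) \<gamma>"
  shows "polar_state d R p (\<rho> * shrink \<rho> u) (1 - (1 + \<rho>) * shrink \<rho> u) (\<lambda>i. (1 - \<gamma>) * x i + \<gamma> * v i)"
proof -
  define r w where r: "r = (\<lambda>i. p i - x i)" and w: "w = (\<lambda>i. v i - x i)"
  define Q where "Q = 2 * u * (1 + \<rho>) + \<rho>\<^sup>2"
  define m where "m = shrink \<rho> u"
  have xR: "x \<in> Rn d" and rr: "ip d r r = (R * \<rho>)\<^sup>2" and rp: "ip d r p = R\<^sup>2 * \<rho> * (1 - u)"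
    using x by (auto simp: polar_state_def r)
  have Q: "0 < Q"
    unfolding Q_def using \<rho> u by (intro add_pos_pos mult_pos_pos) auto
  \<comment> \<open>\<open>R\<^sup>2 Q\<close> turns out to be \<open>\<parallel>w\<parallel>\<^sup>2\<close>.\<close>
  have m2: "m\<^sup>2 * Q = u * (2 - u)"
    using Q u \<rho> unfolding m_def shrink_def Q_def[symmetric] by (subst real_sqrt_pow2) auto
  have vi: "v i = r i / \<rho>" if "i < d" for i
    using fw_direction[OF R \<mu> xR p \<rho>(1) _ v that] rr by (simp add: r)
  have vR: "v \<in> Rn d"
    using v by (simp add: is_arg_min_def ball_Rn_def)
  have wi: "w i = (1 / \<rho> + 1) * r i + (-1) * p i" if "i < d" for i
    using vi[OF that] by (simp add: w r diff_divide_distrib algebra_simps)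
  have wz: "ip d w z = (1 / \<rho> + 1) * ip d r z - ip d p z" for z
    using ip_combination_left[of d "1 / \<rho> + 1" r "-1" p z] ip_cong[OF wi] by simp
  have wr: "ip d w r = R\<^sup>2 * (\<rho> * (u + \<rho>))"
    unfolding wz rr ip_commute[of d p r] rp using \<rho> by (simp add: field_simps power2_eq_square)
  have wp: "ip d w p = R\<^sup>2 * (\<rho> - \<rho> * u - u)"
    unfolding wz rp pp using \<rho> by (simp add: field_simps power2_eq_square)
  have "ip d w w = (1 / \<rho> + 1) * ip d w r - ip d w p"
    unfolding wz[of w] by (simp add: ip_commute)
  also have "\<dots> = R\<^sup>2 * Q"
    unfolding wr wp Q_def using \<rho> by (simp add: field_simps power2_eq_square)
  finally have ww: "ip d w w = R\<^sup>2 * Q" .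
  have "\<rho> * (u + \<rho>) \<le> Q"
    using \<rho> u mult_pos_pos[of \<rho> u] unfolding Q_def by (simp add: algebra_simps power2_eq_square)
  then have "\<gamma> = ip d r w / ip d w w"
    using step_size[OF \<mu> xR p d r w _ _ _ rule] Q \<rho> u R unfolding ww ip_commute[of d r w] wr by simp
  then have \<gamma>: "\<gamma> = \<rho> * (u + \<rho>) / Q"
    unfolding ww ip_commute[of d r w] wr using R by simp
  let ?y = "\<lambda>i. (1 - \<gamma>) * x i + \<gamma> * v i"
  have ry: "(\<lambda>i. p i - ?y i) = (\<lambda>i. 1 * r i + (-\<gamma>) * w i)"
    by (auto simp: r w algebra_simps)
  have "Q * ip d (\<lambda>i. p i - ?y i) (\<lambda>i. p i - ?y i) = R\<^sup>2 * (\<rho>\<^sup>2 * Q - (\<rho> * (u + \<rho>))\<^sup>2)"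
    unfolding ry ip_combination_self rr ip_commute[of d r w] wr ww unfolding \<gamma> using Q
    by (simp add: field_simps power2_eq_square)
  also have "\<rho>\<^sup>2 * Q - (\<rho> * (u + \<rho>))\<^sup>2 = \<rho>\<^sup>2 * (u * (2 - u))"
    unfolding Q_def by (simp add: algebra_simps power2_eq_square)
  also have "R\<^sup>2 * (\<rho>\<^sup>2 * (u * (2 - u))) = Q * (R * (\<rho> * m))\<^sup>2"
    unfolding m2[symmetric] by (simp add: power_mult_distrib)
  finally have 1: "ip d (\<lambda>i. p i - ?y i) (\<lambda>i. p i - ?y i) = (R * (\<rho> * m))\<^sup>2"
    using Q by simp
  have "Q * ip d (\<lambda>i. p i - ?y i) p = R\<^sup>2 * (\<rho> * (1 - u) * Q - \<rho> * (u + \<rho>) * (\<rho> - \<rho> * u - u))"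
    unfolding ry ip_combination_left rp wp unfolding \<gamma> using Q
    by (simp add: field_simps)
  also have "\<rho> * (1 - u) * Q - \<rho> * (u + \<rho>) * (\<rho> - \<rho> * u - u) = \<rho> * (1 + \<rho>) * (u * (2 - u))"
    unfolding Q_def by (simp add: algebra_simps power2_eq_square)
  also have "R\<^sup>2 * (\<rho> * (1 + \<rho>) * (u * (2 - u))) = Q * (R\<^sup>2 * (\<rho> * m) * (1 - (1 - (1 + \<rho>) * m)))"
    unfolding m2[symmetric] by (simp add: power2_eq_square)
  finally have 2: "ip d (\<lambda>i. p i - ?y i) p = R\<^sup>2 * (\<rho> * m) * (1 - (1 - (1 + \<rho>) * m))"
    using Q by simp
  show ?thesis
    using 1 2 Rn_combination[OF xR vR] unfolding polar_state_def m_def by blast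
qed

text \<open>
  This is where \<open>d \<ge> 2\<close> enters: the residual must have a component orthogonal to \<open>p\<close>, so that its
  angle can be prescribed. The starting point lies in the ball because \<open>\<rho> \<le> 2 (1 - u)\<close>.
\<close>

lemma polar_state_exists:
  assumes R: "R > 0" and d: "d \<ge> 2" and \<rho>: "0 < \<rho>" "\<rho> \<le> 1" and u: "0 \<le> u" "u \<le> 1/2"
  obtains x where "x \<in> ball_Rn d R (\<lambda>i. 0)" "polar_state d R (\<lambda>i. R * unit_vec 0 i) \<rho> u x"
proof
  let ?a = "1 - u" and ?b = "sqrt (1 - (1 - u)\<^sup>2)"
  let ?p = "\<lambda>i. R * unit_vec 0 i"
  let ?x = "\<lambda>i. (R * (1 - \<rho> * ?a)) * unit_vec 0 i + (- R * \<rho> * ?b) * unit_vec 1 i"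
  have b2: "?b\<^sup>2 = 1 - ?a\<^sup>2"
    using u by (subst real_sqrt_pow2) (auto simp: power_le_one)
  have e: "ip d (unit_vec 0) (unit_vec 0) = 1" "ip d (unit_vec 1) (unit_vec 1) = 1"
    "ip d (unit_vec 0) (unit_vec 1) = 0" "ip d (unit_vec 1) (unit_vec 0) = 0"
    using d by (simp_all add: ip_unit_vec)
  have xR: "?x \<in> Rn d"
    using d by (intro Rn_combination unit_vec_Rn) auto
  have r: "(\<lambda>i. ?p i - ?x i) = (\<lambda>i. (R * \<rho> * ?a) * unit_vec 0 i + (R * \<rho> * ?b) * unit_vec 1 i)"
    by (auto simp: algebra_simps)
  have "ip d (\<lambda>i. ?p i - ?x i) (\<lambda>i. ?p i - ?x i) = (R * \<rho>)\<^sup>2 * (?a\<^sup>2 + ?b\<^sup>2)"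
    unfolding r ip_combination_self e by (simp only: power_mult_distrib) (simp add: distrib_left)
  moreover have "ip d (\<lambda>i. ?p i - ?x i) ?p = R\<^sup>2 * \<rho> * (1 - u)"
    unfolding r ip_combination_left ip_commute[of d _ ?p]
    using ip_combination_left[of d R "unit_vec 0" 0 "unit_vec 0"] e by (simp add: power2_eq_square)
  ultimately show "polar_state d R ?p \<rho> u ?x"
    using xR unfolding polar_state_def b2 by simp
  have "ip d ?x ?x = R\<^sup>2 * (1 - 2 * \<rho> * ?a + \<rho>\<^sup>2 * (?a\<^sup>2 + ?b\<^sup>2))"
    unfolding ip_combination_self e by (simp add: power_mult_distrib power2_eq_square algebra_simps)
  also have "\<dots> \<le> R\<^sup>2 * 1"
  proof (intro mult_left_mono)
    have "\<rho> * \<rho> \<le> \<rho> * (2 * ?a)"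
      using \<rho> u by (intro mult_left_mono) auto
    then show "1 - 2 * \<rho> * ?a + \<rho>\<^sup>2 * (?a\<^sup>2 + ?b\<^sup>2) \<le> 1"
      unfolding b2 by (simp add: power2_eq_square algebra_simps)
  qed simp
  finally show "?x \<in> ball_Rn d R (\<lambda>i. 0)"
    using xR R by (simp add: mem_origin_ball)
qed

section \<open>The lower bound\<close>

theorem theorem6:
  shows "\<exists>c::real. c > 0 \<and>
    (\<forall>(d::nat) (\<mu>::real) (D::real). d \<ge> 2 \<longrightarrow> \<mu> > 0 \<longrightarrow> D > 0 \<longrightarrow>
      (\<exists>(X :: (nat \<Rightarrow> real) set) (f :: (nat \<Rightarrow> real) \<Rightarrow> real) (xs :: nat \<Rightarrow> real).
         compactin (Euclidean_space d) X \<and> smooth_set d X \<and> strongly_convex_set d X \<and>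
         diam d X = D \<and>
         strongly_convex_fun d \<mu> f \<and> smooth_fun d f \<and>
         is_arg_min f (\<lambda>x. x \<in> X) xs \<and>
         (\<forall>T::nat. \<exists>x0\<in>X. \<forall>x v \<gamma>.
            FW_run d X f T x0 x v \<gamma> \<longrightarrow>
            short_steps d f T x v \<gamma> \<or> exact_line_search f T x v \<gamma> \<longrightarrow>
            (\<forall>t\<in>{1..T}. f (x t) - f xs \<ge> c * (\<mu> * D\<^sup>2 / (real t)\<^sup>2)))))"
proof (intro exI[of _ "1/1152"] conjI allI impI)
  \<comment> \<open>The constant: \<open>\<mu>/2 (R \<rho>)\<^sup>2\<close> with \<open>R = D/2\<close> and \<open>\<rho> \<ge> 1/(12 t)\<close>, and \<open>2 * 4 * 144 = 1152\<close>.\<close>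
  fix d :: nat and \<mu> D :: real
  assume d: "d \<ge> 2" and \<mu>: "\<mu> > 0" and D: "D > 0"
  define R where "R = D / 2"
  define p where "p = (\<lambda>i. R * unit_vec 0 i)"
  let ?X = "ball_Rn d R (\<lambda>i. 0)" and ?f = "sqdist_fun d \<mu> p"
  have R: "R > 0" using D by (simp add: R_def)
  have d1: "d \<ge> 1" using d by simp
  have p: "p \<in> Rn d"
    using Rn_combination[OF unit_vec_Rn unit_vec_Rn, of 0 d 0 R 0] d by (simp add: p_def)
  have pp: "ip d p p = R\<^sup>2"
    using ip_combination_self[of d R "unit_vec 0" 0 "unit_vec 0"] d by (simp add: p_def ip_unit_vec)
  have fp: "?f p = 0"
    by (simp add: sqdist_fun_def L2_set_def)
  have slow: "\<exists>x0\<in>?X. \<forall>x v \<gamma>. FW_run d ?X ?f T x0 x v \<gamma> \<longrightarrow>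
      short_steps d ?f T x v \<gamma> \<or> exact_line_search ?f T x v \<gamma> \<longrightarrow>
      (\<forall>t\<in>{1..T}. ?f (x t) - ?f p \<ge> 1/1152 * (\<mu> * D\<^sup>2 / (real t)\<^sup>2))" for T
  proof -
    obtain \<rho> u :: "nat \<Rightarrow> real" where init: "\<rho> 0 = 1/10" "1/100 \<le> u 0" "u 0 \<le> 1/10"
      and win: "\<And>t. t \<le> T \<Longrightarrow> 0 < \<rho> t \<and> \<rho> t \<le> 1/10 \<and> \<rho> t / 10 < u t \<and> u t < \<rho> t
        \<and> 1 / (10 + 2 * real t) \<le> \<rho> t"
      and step: "\<And>t. t < T \<Longrightarrow> \<rho> (Suc t) = \<rho> t * shrink (\<rho> t) (u t)"
        "\<And>t. t < T \<Longrightarrow> u (Suc t) = 1 - (1 + \<rho> t) * shrink (\<rho> t) (u t)"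
      by (rule slow_orbit[of T]) blast
    obtain x0 where x0: "x0 \<in> ?X" "polar_state d R p (\<rho> 0) (u 0) x0"
      using polar_state_exists[OF R d, of "\<rho> 0" "u 0"] init unfolding p_def by auto
    have "1/1152 * (\<mu> * D\<^sup>2 / (real t)\<^sup>2) \<le> ?f (x t) - ?f p"
      if run: "FW_run d ?X ?f T x0 x v \<gamma>" and rule: "short_steps d ?f T x v \<gamma> \<or> exact_line_search ?f T x v \<gamma>"
        and t: "t \<in> {1..T}" for x v \<gamma> t
    proof -
      have st: "polar_state d R p (\<rho> t) (u t) (x t)" if "t \<le> T" for t
        using that
      proof (induction t)
        case 0
        then show ?case using run x0 by (simp add: FW_run_def)
      next
        case (Suc t)
        then have t: "t < T" "t \<le> T" by auto
        have w: "0 < \<rho> t" "\<rho> t \<le> 1/10" "0 < u t" "u t \<le> \<rho> t"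
          using win[OF t(2)] by auto
        have "(x t \<noteq> v t \<longrightarrow> \<gamma> t = min 1 (ip d (grad d ?f (x t)) (x t - v t) /
                      (smoothness_const d ?f * (nrm d (x t - v t))\<^sup>2)))
          \<or> is_arg_min (\<lambda>s. ?f (\<lambda>i. x t i + s * (v t i - x t i))) (\<lambda>s. s \<in> {0..1}) (\<gamma> t)"
          using rule t(1) unfolding short_steps_def exact_line_search_def by blast
        moreover have "is_arg_min (\<lambda>w. ip d (grad d ?f (x t)) w) (\<lambda>w. w \<in> ?X) (v t)"
          and x_Suc: "x (Suc t) = (\<lambda>i. (1 - \<gamma> t) * x t i + \<gamma> t * v t i)"
          using run t(1) unfolding FW_run_def by blast+
        ultimately show ?case
          unfolding x_Suc step(1)[OF t(1)] step(2)[OF t(1)]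
          using polar_step[OF R \<mu> p pp d1 w Suc.IH[OF t(2)]] by blast
      qed
      have "ip d (x t - p) (x t - p) = ip d (\<lambda>i. p i - x t i) (\<lambda>i. p i - x t i)"
        unfolding ip_def by (intro sum.cong) (auto simp: algebra_simps)
      then have "?f (x t) = \<mu> / 2 * (R * \<rho> t)\<^sup>2"
        using st[of t] t by (simp add: sqdist_fun_def nrm_sq polar_state_def)
      moreover have "1 / (12 * real t) \<le> \<rho> t"
      proof -
        \<comment> \<open>The bound \<open>t \<ge> 1\<close> is used in \<open>10 + 2 t \<le> 12 t\<close>.\<close>
        have "1 / (12 * real t) \<le> 1 / (10 + 2 * real t)"
          using t by (intro divide_left_mono) auto
        then show ?thesis using win[of t] t by auto
      qed
      then have "\<mu> / 2 * (R * (1 / (12 * real t)))\<^sup>2 \<le> \<mu> / 2 * (R * \<rho> t)\<^sup>2"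
        using R \<mu> t by (intro mult_left_mono power_mono) auto
      moreover have "\<mu> / 2 * (R * (1 / (12 * real t)))\<^sup>2 = 1/1152 * (\<mu> * D\<^sup>2 / (real t)\<^sup>2)"
        by (simp add: R_def power_mult_distrib power_divide)
      ultimately show ?thesis
        using fp by simp
    qed
    then show ?thesis using x0 by blast
  qed
  have "is_arg_min ?f (\<lambda>x. x \<in> ?X) p"
    using R p pp fp \<mu> by (auto simp: is_arg_min_def mem_origin_ball not_less sqdist_fun_def)
  moreover have "smooth_fun d ?f"
    unfolding smooth_fun_def using \<mu> L_smooth_sqdist_fun_iff[OF p d1] by blast
  ultimately show "\<exists>X f xs. compactin (Euclidean_space d) X \<and> smooth_set d X \<and> strongly_convex_set d X \<and>
         diam d X = D \<and> strongly_convex_fun d \<mu> f \<and> smooth_fun d f \<and> is_arg_min f (\<lambda>x. x \<in> X) xs \<and>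
         (\<forall>T::nat. \<exists>x0\<in>X. \<forall>x v \<gamma>. FW_run d X f T x0 x v \<gamma> \<longrightarrow>
            short_steps d f T x v \<gamma> \<or> exact_line_search f T x v \<gamma> \<longrightarrow>
            (\<forall>t\<in>{1..T}. f (x t) - f xs \<ge> 1/1152 * (\<mu> * D\<^sup>2 / (real t)\<^sup>2)))"
    using compact_origin_ball[of d R] origin_ball_smooth_strongly_convex[OF R, of d] diam_origin_ball[OF R d1]
      strongly_convex_sqdist_fun[OF p, of \<mu>] slow
    by (intro exI[of _ ?X] exI[of _ ?f] exI[of _ p]) (simp add: R_def)
qed simp

end
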